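(* Let $G$ be a regular graph of degree $r\geqslant 2$. Then $\chi'_a(G)\leqslant (5r+37)/3$.
   Context: All graphs are finite, without self-loops or multiple edges, and without isolated vertices. A graph is regular of degree $r$ if every vertex has degree $r$. A graph $G$ is normal if it contains no isolated edges (an isolated edge is an edge both of whose end vertices have degree $1$). An edge $k$-coloring of $G$ is a function $\phi:E(G)\to\{1,2,\ldots,k\}$ such that any two incident edges (edges sharing an end vertex) receive different colors. For an edge coloring $\phi$ and a vertex $v$, $C_\phi(v)$ denotes the set of colors assigned by $\phi$ to the edges incident to $v$. The coloring $\phi$ is an adjacent vertex distinguishing edge coloring if $C_\phi(u)\neq C_\phi(v)$ for every pair of adjacent vertices $u,v$. For a normal graph $G$, the adjacent vertex distinguishing chromatic index $\chi'_a(G)$ is the smallest integer $k$ such that $G$ has an adjacent vertex distinguishing edge $k$-coloring. *)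

theory Defs
  imports Complex_Main
begin

text \<open>
  Edges are two-element subsets of the vertex set, so loops and multiple edges cannot occur.
  Isolated vertices are excluded as well; every graph is understood in this sense.
\<close>

locale simple_graph =
  fixes V :: "'a set" and E :: "'a set set"
  assumes finite_V: "finite V"
    and edge_subset: "e \<in> E \<Longrightarrow> e \<subseteq> V"
    and edge_card: "e \<in> E \<Longrightarrow> card e = 2"
    and no_isolated_vertex: "v \<in> V \<Longrightarrow> \<exists>e\<in>E. v \<in> e"

definition incident_edges :: "'a set set \<Rightarrow> 'a \<Rightarrow> 'a set set" where
  "incident_edges E v = {e \<in> E. v \<in> e}"

definition vertex_degree :: "'a set set \<Rightarrow> 'a \<Rightarrow> nat" where
  "vertex_degree E v = card (incident_edges E v)"

definition regular_graph :: "'a set \<Rightarrow> 'a set set \<Rightarrow> nat \<Rightarrow> bool" where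
  "regular_graph V E r \<longleftrightarrow> (\<forall>v\<in>V. vertex_degree E v = r)"

definition normal_graph :: "'a set set \<Rightarrow> bool" where
  "normal_graph E \<longleftrightarrow> \<not> (\<exists>e\<in>E. \<forall>v\<in>e. vertex_degree E v = 1)"

text \<open>Only the values of a coloring on \<open>E\<close> matter.\<close>

definition edge_coloring :: "'a set set \<Rightarrow> nat \<Rightarrow> ('a set \<Rightarrow> nat) \<Rightarrow> bool" where
  "edge_coloring E k \<phi> \<longleftrightarrow>
     (\<forall>e\<in>E. \<phi> e \<in> {1..k}) \<and>
     (\<forall>e\<in>E. \<forall>f\<in>E. e \<noteq> f \<and> e \<inter> f \<noteq> {} \<longrightarrow> \<phi> e \<noteq> \<phi> f)"

definition colors_at :: "'a set set \<Rightarrow> ('a set \<Rightarrow> nat) \<Rightarrow> 'a \<Rightarrow> nat set" where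
  "colors_at E \<phi> v = \<phi> ` incident_edges E v"

definition avd_edge_coloring :: "'a set set \<Rightarrow> nat \<Rightarrow> ('a set \<Rightarrow> nat) \<Rightarrow> bool" where
  "avd_edge_coloring E k \<phi> \<longleftrightarrow>
     edge_coloring E k \<phi> \<and>
     (\<forall>u v. {u, v} \<in> E \<longrightarrow> colors_at E \<phi> u \<noteq> colors_at E \<phi> v)"

text \<open>
  Meaningful for normal graphs, where the set of admissible \<open>k\<close> is nonempty
  (lemma \<open>avd_edge_coloring_exists\<close> below).
\<close>

definition avd_chromatic_index :: "'a set set \<Rightarrow> nat" where
  "avd_chromatic_index E = (LEAST k. \<exists>\<phi>. avd_edge_coloring E k \<phi>)"

context simple_graph
begin

lemma finite_E: "finite E"
proof (rule finite_subset)
  show "E \<subseteq> Pow V" using edge_subset by blast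
qed (simp add: finite_V)

lemma regular_imp_normal:
  assumes "regular_graph V E r" "r \<ge> 2"
  shows "normal_graph E"
  unfolding normal_graph_def
proof
  assume "\<exists>e\<in>E. \<forall>v\<in>e. vertex_degree E v = 1"
  then obtain e where e: "e \<in> E" "\<forall>v\<in>e. vertex_degree E v = 1" by blast
  obtain v where v: "v \<in> e" using edge_card[OF e(1)] by fastforce
  then have "v \<in> V" using edge_subset[OF e(1)] by blast
  then show False using assms e(2) v by (auto simp: regular_graph_def)
qed

lemma avd_edge_coloring_exists:
  assumes "normal_graph E"
  shows "\<exists>k \<phi>. avd_edge_coloring E k \<phi>"
proof -
  obtain g where g: "bij_betw g E {1..card E}"
    using finite_same_card_bij[OF finite_E, of "{1..card E}"] by auto
  then have inj: "inj_on g E" by (simp add: bij_betw_def)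
  have "edge_coloring E (card E) g"
    unfolding edge_coloring_def using g inj by (auto simp: bij_betw_def inj_on_def)
  moreover have "colors_at E g u \<noteq> colors_at E g v" if uv: "{u, v} \<in> E" for u v
  proof
    assume "colors_at E g u = colors_at E g v"
    moreover have "incident_edges E u \<subseteq> E" "incident_edges E v \<subseteq> E"
      by (auto simp: incident_edges_def)
    ultimately have eq: "incident_edges E u = incident_edges E v"
      using inj_on_image_eq_iff[OF inj] by (simp add: colors_at_def)
    have "f = {u, v}" if "f \<in> incident_edges E u" for f
    proof -
      have f: "f \<in> E" "u \<in> f" "v \<in> f"
        using that eq by (auto simp: incident_edges_def)
      have "finite f" using edge_subset[OF f(1)] finite_V by (rule finite_subset)
      moreover have "{u, v} \<subseteq> f" using f by simp
      moreover have "card {u, v} = card f" using edge_card uv f(1) by metis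
      ultimately show ?thesis using card_subset_eq by blast
    qed
    then have "incident_edges E u = {{u, v}}"
      using uv by (auto simp: incident_edges_def)
    then have "\<forall>w\<in>{u, v}. vertex_degree E w = 1" using eq by (simp add: vertex_degree_def)
    then show False using assms uv unfolding normal_graph_def by blast
  qed
  ultimately show ?thesis unfolding avd_edge_coloring_def by blast
qed

end

end

theory Submission
  imports Defs "HOL-Combinatorics.Transposition"
begin

text \<open>
  By Vizing's theorem \<open>G\<close> has a proper coloring with \<open>r + 1\<close> colors, so exactly one color is missing at
  each vertex. Call an edge a conflict if its ends miss the same color. If the sum of all edge
  colors is minimal, a conflict whose ends miss \<open>i\<close> has a color below \<open>i\<close>, since it could be recolored
  with \<open>i\<close>. The first four color classes are split into 6, \<open>2 d + 3\<close>, 3 and 3 new colors, where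
  \<open>d = (r - 1) div 3\<close>. A class that is a matching acts on the graph obtained by contracting it, so a
  splitting into \<open>q\<close> colors with fewest unresolved conflicts leaves at most a fraction \<open>1 / q\<close> of those
  at any contracted edge. After the first split a vertex has at most \<open>d\<close> conflicts
  besides its edge of color 1. After the second one only conflicts of color 2, or of color 1 at
  vertices missing 2, remain: at most one at each vertex, and the last two splits remove them. The
  total is \<open>r + 12 + 2 d\<close>, which is at most \<open>(5 r + 34) / 3\<close>.
\<close>

section \<open>Proper colorings, seen from the vertices\<close>

lemma doubleton_of_card_2:
  assumes "card e = 2" "v \<in> e"
  obtains w where "e = {v, w}" "w \<noteq> v"
  using assms by (auto simp: card_2_iff)

lemma incident_edges_eq:
  assumes "\<forall>e\<in>E. card e = 2"
  shows "incident_edges E v = (\<lambda>w. {v, w}) ` {w. {v, w} \<in> E}"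
  using assms by (auto simp: incident_edges_def elim!: doubleton_of_card_2)

lemma vertex_degree_eq:
  assumes "\<forall>e\<in>E. card e = 2"
  shows "vertex_degree E v = card {w. {v, w} \<in> E}"
  unfolding vertex_degree_def incident_edges_eq[OF assms]
  by (rule card_image) (auto simp: inj_on_def doubleton_eq_iff)

lemma finite_neighbors:
  assumes "finite E" "\<forall>e\<in>E. card e = 2"
  shows "finite {w. {v, w} \<in> E}"
proof (rule finite_subset)
  show "{w. {v, w} \<in> E} \<subseteq> \<Union>E" by auto
  have "finite e" if "e \<in> E" for e using assms(2) that by (metis card.infinite zero_neq_numeral)
  then show "finite (\<Union>E)" using assms(1) by blast
qed

lemma colors_at_iff:
  assumes "\<forall>e\<in>E. card e = 2"
  shows "i \<in> colors_at E c v \<longleftrightarrow> (\<exists>w. {v, w} \<in> E \<and> c {v, w} = i)"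
  by (auto simp: colors_at_def incident_edges_eq[OF assms])

lemma edge_coloring_iff:
  assumes "\<forall>e\<in>E. card e = 2"
  shows "edge_coloring E k c \<longleftrightarrow> (\<forall>e\<in>E. c e \<in> {1..k}) \<and>
    (\<forall>u v w. {u, v} \<in> E \<and> {u, w} \<in> E \<and> c {u, v} = c {u, w} \<longrightarrow> v = w)" (is "?l \<longleftrightarrow> ?r")
proof
  assume l: ?l
  have "v = w" if "{u, v} \<in> E" "{u, w} \<in> E" "c {u, v} = c {u, w}" for u v w
  proof -
    have "{u, v} \<inter> {u, w} \<noteq> {}" by auto
    then have "{u, v} = {u, w}" using l that unfolding edge_coloring_def by metis
    then show ?thesis by (auto simp: doubleton_eq_iff)
  qed
  then show ?r using l unfolding edge_coloring_def by blast
next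
  assume r: ?r
  have "e = f" if ef: "e \<in> E" "f \<in> E" "e \<inter> f \<noteq> {}" "c e = c f" for e f
  proof -
    obtain u where u: "u \<in> e" "u \<in> f" using ef(3) by blast
    obtain v where v: "e = {u, v}" using assms ef(1) u(1) doubleton_of_card_2 by metis
    obtain w where w: "f = {u, w}" using assms ef(2) u(2) doubleton_of_card_2 by metis
    show ?thesis using r ef v w by auto
  qed
  then show ?l using r unfolding edge_coloring_def by blast
qed

lemma edge_coloring_inj:
  assumes "edge_coloring E k c" "{u, v} \<in> E" "{u, w} \<in> E" "c {u, v} = c {u, w}"
  shows "v = w"
proof -
  have "{u, v} \<inter> {u, w} \<noteq> {}" by auto
  then have "{u, v} = {u, w}" using assms unfolding edge_coloring_def by metis
  then show ?thesis by (auto simp: doubleton_eq_iff)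
qed

lemma colors_at_subset:
  assumes "edge_coloring E k c"
  shows "colors_at E c v \<subseteq> {1..k}"
  using assms by (auto simp: edge_coloring_def colors_at_def incident_edges_def)

lemma card_colors_at:
  assumes "edge_coloring E k c"
  shows "card (colors_at E c v) = vertex_degree E v"
  unfolding colors_at_def vertex_degree_def
proof (rule card_image, rule inj_onI)
  fix e f assume "e \<in> incident_edges E v" "f \<in> incident_edges E v" "c e = c f"
  then show "e = f" using assms unfolding edge_coloring_def incident_edges_def by blast
qed

lemma ex_missing_color:
  assumes "edge_coloring E k c" "vertex_degree E v < k"
  obtains i where "i \<in> {1..k}" "i \<notin> colors_at E c v"
proof -
  have "\<not> {1..k} \<subseteq> colors_at E c v"
  proof
    assume "{1..k} \<subseteq> colors_at E c v"
    moreover have "finite (colors_at E c v)"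
      using colors_at_subset[OF assms(1)] finite_subset by blast
    ultimately have "card {1..k} \<le> card (colors_at E c v)" by (rule card_mono[rotated])
    then show False using assms by (simp add: card_colors_at)
  qed
  then show thesis using that by blast
qed

text \<open>A vertex that misses the color \<open>i\<close> is its own partner, which makes the map an involution.\<close>

definition partner :: "'a set set \<Rightarrow> ('a set \<Rightarrow> nat) \<Rightarrow> nat \<Rightarrow> 'a \<Rightarrow> 'a" where
  "partner E c i v = (if \<exists>w. {v, w} \<in> E \<and> c {v, w} = i
     then SOME w. {v, w} \<in> E \<and> c {v, w} = i else v)"

context
  fixes E :: "'a set set" and k :: nat and c :: "'a set \<Rightarrow> nat"
  assumes card_2: "\<forall>e\<in>E. card e = 2" and coloring: "edge_coloring E k c"
begin

lemma partner_eq: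
  assumes "{v, w} \<in> E" "c {v, w} = i"
  shows "partner E c i v = w"
proof -
  have "(SOME w. {v, w} \<in> E \<and> c {v, w} = i) = w"
    by (rule some_equality) (use assms edge_coloring_inj[OF coloring] in blast)+
  then show ?thesis using assms unfolding partner_def by auto
qed

lemma partner_missing: "i \<notin> colors_at E c v \<Longrightarrow> partner E c i v = v"
  using colors_at_iff[OF card_2] unfolding partner_def by metis

lemma partner_edge:
  assumes "i \<in> colors_at E c v"
  shows "{v, partner E c i v} \<in> E" "c {v, partner E c i v} = i"
  using assms colors_at_iff[OF card_2] partner_eq by metis+

lemma partner_partner: "partner E c i (partner E c i v) = v"
proof (cases "i \<in> colors_at E c v")
  case True
  then show ?thesis using partner_edge[OF True] by (intro partner_eq) (auto simp: insert_commute)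
qed (simp add: partner_missing)

end

section \<open>Kempe changes and Vizing's theorem\<close>

text \<open>
  The orbit of \<open>x\<close> is the path starting at \<open>x\<close> whose edges are alternately given by \<open>b\<close> and
  \<open>a\<close>; a \<open>b\<close>-fixed point can only be its other end.
\<close>

lemma involutions_orbit:
  fixes a b :: "'a \<Rightarrow> 'a"
  assumes a: "\<And>v. a (a v) = v" and b: "\<And>v. b (b v) = v" and x: "a x = x"
    and R: "\<And>u v. (u, v) \<in> R \<Longrightarrow> v = a u \<or> v = b u"
    and y: "(x, y) \<in> R\<^sup>*" "b y = y" and w: "(x, w) \<in> R\<^sup>*" "b w = w"
  shows "y = w"
proof -
  \<comment> \<open>Two involutions generate a dihedral group. The rotations \<open>t\<close> and
    \<open>s\<close> are inverse to each other, and since \<open>a\<close> fixes \<open>x\<close>,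
    every vertex reachable from \<open>x\<close> is a rotate of \<open>x\<close>.\<close>
  define t where "t = a \<circ> b"
  define s where "s = b \<circ> a"
  have ts: "(t ^^ n) ((s ^^ n) z) = z" for n z
  proof (induction n)
    case (Suc n)
    have "(t ^^ Suc n) ((s ^^ Suc n) z) = (t ^^ n) (t (s ((s ^^ n) z)))"
      by (simp add: funpow_swap1)
    also have "\<dots> = (t ^^ n) ((s ^^ n) z)" by (simp add: t_def s_def a b)
    finally show ?case using Suc.IH by simp
  qed simp
  have as: "a ((s ^^ n) z) = (t ^^ n) (a z)" for n z
    by (induction n) (auto simp: t_def s_def)
  have bt: "b ((t ^^ n) z) = (s ^^ n) (b z)" for n z
    by (induction n) (auto simp: t_def s_def)
  have at: "a ((t ^^ n) x) = (s ^^ n) x" for n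
    using as[of n x] a x by metis
  have bs: "b ((s ^^ n) x) = (t ^^ n) (b x)" for n
    using bt[of n "b x"] b by metis
  have bx: "b x = s x" and ax: "a (b x) = t x" by (simp_all add: s_def t_def x)
  have orbit: "\<exists>n. u = (t ^^ n) x \<or> u = (s ^^ n) x" if "(x, u) \<in> R\<^sup>*" for u
    using that
  proof (induction rule: rtrancl_induct)
    case base
    show ?case by (auto intro: exI[of _ 0])
  next
    case (step u v)
    have "\<exists>m. a ((t ^^ n) x) = (t ^^ m) x \<or> a ((t ^^ n) x) = (s ^^ m) x" for n
      using at by blast
    moreover have "\<exists>m. a ((s ^^ n) x) = (t ^^ m) x \<or> a ((s ^^ n) x) = (s ^^ m) x" for n
      using as x by metis
    moreover have "b ((t ^^ n) x) = (s ^^ Suc n) x" for n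
      using bt[of n x] bx by (simp add: funpow_swap1)
    moreover have "\<exists>m. b ((s ^^ n) x) = (t ^^ m) x \<or> b ((s ^^ n) x) = (s ^^ m) x" for n
    proof (cases n)
      case 0
      then show ?thesis using bx by (auto intro!: exI[of _ 1])
    next
      case (Suc l)
      then have "b ((s ^^ n) x) = (t ^^ l) x" using as[of l x] x by (simp add: s_def b)
      then show ?thesis by blast
    qed
    ultimately show ?case using R[OF step.hyps(2)] step.IH by metis
  qed
  have fixed: "\<exists>n. u = (t ^^ n) x \<and> (t ^^ Suc (2 * n)) x = x" if u: "(x, u) \<in> R\<^sup>*" "b u = u" for u
  proof -
    obtain n where "u = (t ^^ n) x"
    proof (rule exE[OF orbit[OF u(1)]])
      fix n assume n: "u = (t ^^ n) x \<or> u = (s ^^ n) x"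
      show thesis
      proof (cases "u = (t ^^ n) x")
        case True
        then show ?thesis using that by blast
      next
        case False
        with n have us: "u = (s ^^ n) x" by blast
        with False obtain l where l: "n = Suc l" by (cases n) auto
        have "b u = (t ^^ l) x" unfolding us l using as[of l x] x by (simp add: s_def b)
        then show ?thesis using u that by simp
      qed
    qed
    moreover have "(t ^^ Suc (2 * n)) x = x" if "u = (t ^^ n) x"
    proof -
      \<comment> \<open>A \<open>b\<close>-fixed rotate closes the orbit with odd period: applying
        \<open>t\<close> another \<open>Suc n\<close> times undoes the right-hand side.\<close>
      have "(t ^^ n) x = (s ^^ Suc n) x"
        using u(2) bt[of n x] bx that by (simp add: funpow_swap1)
      then have "(t ^^ Suc n) ((t ^^ n) x) = x" using ts by metis
      then show ?thesis by (simp add: funpow_add mult_2)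
    qed
    ultimately show ?thesis by blast
  qed
  have mult: "(t ^^ (p * l)) x = x" if "(t ^^ p) x = x" for p l
    using that by (induction l) (auto simp: funpow_add)
  have le: "(t ^^ n) x = (t ^^ m) x"
    if nm: "n \<le> m" and n: "(t ^^ Suc (2 * n)) x = x" and m: "(t ^^ Suc (2 * m)) x = x" for n m
  proof -
    obtain d where d: "m = n + d" using nm le_Suc_ex by blast
    have "2 * d + Suc (2 * n) = Suc (2 * m)" by (simp add: d)
    then have "(t ^^ (2 * d)) ((t ^^ Suc (2 * n)) x) = (t ^^ Suc (2 * m)) x"
      by (metis funpow_add comp_apply)
    then have 2: "(t ^^ (2 * d)) x = x" using n m by simp
    \<comment> \<open>The two odd periods differ by \<open>2 * d\<close>, which is therefore a
      period too. Since \<open>d\<close> is an odd multiple \<open>Suc (2 * n) * d\<close> minus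
      \<open>n\<close> times \<open>2 * d\<close>, it is itself a period, so both rotates
      coincide.\<close>
    have "d + 2 * d * n = Suc (2 * n) * d" by simp
    then have "(t ^^ d) ((t ^^ (2 * d * n)) x) = (t ^^ (Suc (2 * n) * d)) x"
      by (metis funpow_add comp_apply)
    then have "(t ^^ d) x = x" using mult[OF 2, of n] mult[OF n, of d] by simp
    then show ?thesis by (simp add: d funpow_add)
  qed
  obtain n where n: "y = (t ^^ n) x" "(t ^^ Suc (2 * n)) x = x" using fixed[OF y] by blast
  obtain m where m: "w = (t ^^ m) x" "(t ^^ Suc (2 * m)) x = x" using fixed[OF w] by blast
  show ?thesis using le[OF _ n(2) m(2)] le[OF _ m(2) n(2)] n(1) m(1) nat_le_linear by metis
qed

section \<open>Paths alternating between two colors\<close>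

definition kempe :: "'a set set \<Rightarrow> ('a set \<Rightarrow> nat) \<Rightarrow> nat \<Rightarrow> nat \<Rightarrow> ('a \<times> 'a) set" where
  "kempe E c \<alpha> \<beta> = {(u, v). {u, v} \<in> E \<and> c {u, v} \<in> {\<alpha>, \<beta>}}"

lemma kempe_connected_sym:
  assumes "(u, v) \<in> (kempe E c \<alpha> \<beta>)\<^sup>*"
  shows "(v, u) \<in> (kempe E c \<alpha> \<beta>)\<^sup>*"
proof -
  have "sym (kempe E c \<alpha> \<beta>)" by (auto simp: sym_def kempe_def insert_commute)
  then show ?thesis using assms by (meson sym_rtrancl symD)
qed

text \<open>A vertex missing a color is a fixed point of the corresponding \<open>partner\<close>
  map, so this is \<open>involutions_orbit\<close>: a path that starts at a vertex missing \<alpha>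
  has only one end missing \<beta>.\<close>

lemma kempe_ends:
  assumes "\<forall>e\<in>E. card e = 2" "edge_coloring E k c"
    and "\<alpha> \<notin> colors_at E c x" "\<beta> \<notin> colors_at E c y" "\<beta> \<notin> colors_at E c w"
    and "(x, y) \<in> (kempe E c \<alpha> \<beta>)\<^sup>*" "(x, w) \<in> (kempe E c \<alpha> \<beta>)\<^sup>*"
  shows "y = w"
proof (rule involutions_orbit[where a="partner E c \<alpha>" and b="partner E c \<beta>" and x=x])
  fix u v assume "(u, v) \<in> kempe E c \<alpha> \<beta>"
  then show "v = partner E c \<alpha> u \<or> v = partner E c \<beta> u"
    using partner_eq[OF assms(1,2)] by (auto simp: kempe_def)
qed (use assms in \<open>auto simp: partner_partner partner_missing\<close>)

lemma kempe_swap: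
  assumes card_2: "\<forall>e\<in>E. card e = 2" and col: "edge_coloring E k c"
    and ab: "\<alpha> \<in> {1..k}" "\<beta> \<in> {1..k}"
    and K: "K = (kempe E c \<alpha> \<beta>)\<^sup>* `` {x}"
  obtains c' where "edge_coloring E k c'"
    and "\<And>v w. {v, w} \<in> E \<Longrightarrow>
      c' {v, w} = (if v \<in> K then transpose \<alpha> \<beta> (c {v, w}) else c {v, w})"
    and "\<And>v. v \<in> K \<Longrightarrow> colors_at E c' v = transpose \<alpha> \<beta> ` colors_at E c v"
    and "\<And>v. v \<notin> K \<Longrightarrow> colors_at E c' v = colors_at E c v"
proof
  \<comment> \<open>An edge with exactly one end in \<open>K\<close> has neither of the two colors,
    so the transposition leaves it alone and it does not matter which end is tested.\<close>
  define c' where "c' e = (if e \<inter> K \<noteq> {} then transpose \<alpha> \<beta> (c e) else c e)" for e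
  have closed: "v \<in> K" if "u \<in> K" "{u, v} \<in> E" "c {u, v} \<in> {\<alpha>, \<beta>}" for u v
    using that unfolding K kempe_def by (auto intro: rtrancl_into_rtrancl)
  show c': "c' {v, w} = (if v \<in> K then transpose \<alpha> \<beta> (c {v, w}) else c {v, w})"
    if "{v, w} \<in> E" for v w
  proof (cases "v \<in> K \<or> w \<notin> K")
    case True
    then show ?thesis by (auto simp: c'_def)
  next
    case False
    then have "c {v, w} \<notin> {\<alpha>, \<beta>}" using closed[of w v] that by (auto simp: insert_commute)
    then show ?thesis using False by (auto simp: c'_def)
  qed
  show "colors_at E c' v = transpose \<alpha> \<beta> ` colors_at E c v" if "v \<in> K" for v
    using c' that unfolding colors_at_def incident_edges_eq[OF card_2] by (auto simp: image_image)
  show "colors_at E c' v = colors_at E c v" if "v \<notin> K" for v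
    using c' that unfolding colors_at_def incident_edges_eq[OF card_2] by (auto simp: image_image)
  show "edge_coloring E k c'"
    unfolding edge_coloring_iff[OF card_2]
  proof (intro conjI allI impI ballI)
    fix e assume "e \<in> E"
    then have "c e \<in> {1..k}" using col by (simp add: edge_coloring_def)
    then show "c' e \<in> {1..k}" using ab by (auto simp: c'_def transpose_def)
  next
    fix u v w assume "{u, v} \<in> E \<and> {u, w} \<in> E \<and> c' {u, v} = c' {u, w}"
    moreover from this have "c {u, v} = c {u, w}"
      by (auto simp: c' split: if_splits dest: injD[OF inj_transpose])
    ultimately show "v = w" using edge_coloring_inj[OF col] by metis
  qed
qed

section \<open>Vizing fans\<close>

definition is_fan :: "'a set set \<Rightarrow> ('a set \<Rightarrow> nat) \<Rightarrow> 'a \<Rightarrow> (nat \<Rightarrow> 'a) \<Rightarrow> nat \<Rightarrow> bool" where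
  "is_fan E c x y n \<longleftrightarrow> inj_on y {..n} \<and> x \<noteq> y 0 \<and> {x, y 0} \<notin> E \<and>
     (\<forall>j<n. {x, y (Suc j)} \<in> E \<and> c {x, y (Suc j)} \<notin> colors_at E c (y j))"

lemma edge_coloring_insert:
  assumes "\<forall>e\<in>E. card e = 2" "edge_coloring E k c" "x \<noteq> y" "\<alpha> \<in> {1..k}"
    and "{x, y} \<notin> E" "\<alpha> \<notin> colors_at E c x" "\<alpha> \<notin> colors_at E c y"
  shows "edge_coloring (insert {x, y} E) k (c({x, y} := \<alpha>))"
  unfolding edge_coloring_def
proof (intro conjI ballI impI)
  fix e assume "e \<in> insert {x, y} E"
  then show "(c({x, y} := \<alpha>)) e \<in> {1..k}" using assms(2,4) by (auto simp: edge_coloring_def)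
next
  fix e f assume e: "e \<in> insert {x, y} E" and f: "f \<in> insert {x, y} E" and
    ef: "e \<noteq> f \<and> e \<inter> f \<noteq> {}"
  have *: "c g \<noteq> \<alpha>" if "g \<in> E" "g \<inter> {x, y} \<noteq> {}" for g
    using assms(6,7) that by (auto simp: colors_at_def incident_edges_def)
  show "(c({x, y} := \<alpha>)) e \<noteq> (c({x, y} := \<alpha>)) f"
    using e f ef *[of e] *[of f] assms(2,5) by (auto simp: edge_coloring_def Int_commute)
qed

text \<open>Every fan edge hands its color to the preceding one, which is possible because that
  color is missing at the preceding vertex; the last edge takes \<alpha>. The uncolored edge of a
  partial coloring is modelled as an edge outside \<open>E\<close>, so one step of the induction
  adds \<open>{x, y 0}\<close>, removes \<open>{x, y 1}\<close> and leaves a fan shorter by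
  one.\<close>

lemma fan_rotate:
  assumes "\<forall>e\<in>E. card e = 2" "edge_coloring E k c" "is_fan E c x y n"
    and "\<alpha> \<in> {1..k}" "\<alpha> \<notin> colors_at E c x" "\<alpha> \<notin> colors_at E c (y n)"
  shows "\<exists>c'. edge_coloring (insert {x, y 0} E) k c'"
  using assms
proof (induction n arbitrary: E c y)
  case 0
  then show ?case by (auto simp: is_fan_def intro!: exI edge_coloring_insert)
next
  case (Suc n)
  note card_2 = \<open>\<forall>e\<in>E. card e = 2\<close> and col = \<open>edge_coloring E k c\<close> and fan = \<open>is_fan E c x y (Suc n)\<close>
  have inj: "inj_on y {..Suc n}" and x0: "x \<noteq> y 0" "{x, y 0} \<notin> E"
    and step: "\<And>j. j < Suc n \<Longrightarrow> {x, y (Suc j)} \<in> E \<and> c {x, y (Suc j)} \<notin> colors_at E c (y j)"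
    using fan by (auto simp: is_fan_def)
  have x1: "{x, y 1} \<in> E" "c {x, y 1} \<notin> colors_at E c (y 0)" using step[of 0] by auto
  have xy: "x \<noteq> y j" if "j \<le> Suc n" for j
  proof (cases j)
    case (Suc l)
    then show ?thesis using step[of l] that card_2 by force
  qed (use x0 in simp)
  have y_eq: "y i = y j \<longleftrightarrow> i = j" if "i \<le> Suc n" "j \<le> Suc n" for i j
    using inj that by (auto simp: inj_on_def)
  define D where "D = E - {{x, y 1}}"
  define E' where "E' = insert {x, y 0} D"
  define c' where "c' = c({x, y 0} := c {x, y 1})"
  have D: "\<forall>e\<in>D. card e = 2" "edge_coloring D k c"
    using card_2 col by (auto simp: D_def edge_coloring_def)
  have D_at: "colors_at D c v \<subseteq> colors_at E c v" for v
    by (auto simp: colors_at_def incident_edges_def D_def)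
  have D_x: "c {x, y 1} \<notin> colors_at D c v" if "v \<in> {x, y 1}" for v
  proof
    assume "c {x, y 1} \<in> colors_at D c v"
    then obtain g where "g \<in> incident_edges D v" "c g = c {x, y 1}"
      unfolding colors_at_def by (metis imageE)
    then have "g \<in> E" "g \<noteq> {x, y 1}" "v \<in> g" "c g = c {x, y 1}"
      by (simp_all add: incident_edges_def D_def)
    moreover from this have "g \<inter> {x, y 1} \<noteq> {}" using that by blast
    ultimately show False using col x1(1) unfolding edge_coloring_def by metis
  qed
  have E'_2: "\<forall>e\<in>E'. card e = 2" using D x0 by (auto simp: E'_def)
  have E'_at: "colors_at E' c' v \<subseteq> colors_at D c v" if "v \<notin> {x, y 0}" for v
    using that by (auto simp: colors_at_def incident_edges_def E'_def c'_def)
  have "edge_coloring E' k c'"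
    unfolding E'_def c'_def using D x0 x1 D_x D_at[of "y 0"] col
    by (intro edge_coloring_insert) (auto simp: D_def edge_coloring_def)
  \<comment> \<open>Only \<open>x\<close> and \<open>y 0\<close> can see a new color, and the later
    fan edges keep theirs, so every remaining fan condition survives.\<close>
  moreover have "is_fan E' c' x (y \<circ> Suc) n"
    unfolding is_fan_def
  proof (intro conjI allI impI)
    show "inj_on (y \<circ> Suc) {..n}" using inj by (auto simp: inj_on_def)
    show "x \<noteq> (y \<circ> Suc) 0" using xy[of 1] by simp
    show "{x, (y \<circ> Suc) 0} \<notin> E'" using y_eq[of 0 1] xy[of 0] by (auto simp: E'_def D_def doubleton_eq_iff)
    fix j assume j: "j < n"
    then show "{x, (y \<circ> Suc) (Suc j)} \<in> E'"
      using step[of "Suc j"] y_eq[of 1 "Suc (Suc j)"] xy[of 1]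
      by (auto simp: E'_def D_def doubleton_eq_iff)
    have "c {x, y (Suc (Suc j))} \<notin> colors_at E c (y (Suc j))" using step j by simp
    moreover have "colors_at E' c' (y (Suc j)) \<subseteq> colors_at E c (y (Suc j))"
      using E'_at[of "y (Suc j)"] D_at[of "y (Suc j)"] j y_eq[of "Suc j" 0] xy[of "Suc j"] by auto
    moreover have "c' {x, y (Suc (Suc j))} = c {x, y (Suc (Suc j))}"
      using y_eq[of "Suc (Suc j)" 0] j xy[of 0] by (auto simp: c'_def doubleton_eq_iff)
    ultimately show "c' {x, (y \<circ> Suc) (Suc j)} \<notin> colors_at E' c' ((y \<circ> Suc) j)" by auto
  qed
  moreover have "\<alpha> \<notin> colors_at E' c' x"
  proof
    assume "\<alpha> \<in> colors_at E' c' x"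
    then have "\<alpha> \<in> colors_at E c x"
      using x1(1) by (auto simp: colors_at_def incident_edges_def E'_def D_def c'_def split: if_splits)
    then show False using Suc.prems by blast
  qed
  moreover have "\<alpha> \<notin> colors_at E' c' ((y \<circ> Suc) n)"
    using E'_at[of "y (Suc n)"] D_at[of "y (Suc n)"] y_eq[of "Suc n" 0] xy[of "Suc n"] Suc.prems by auto
  ultimately have "\<exists>c''. edge_coloring (insert {x, (y \<circ> Suc) 0} E') k c''"
    using Suc.IH E'_2 \<open>\<alpha> \<in> {1..k}\<close> by blast
  moreover have "insert {x, (y \<circ> Suc) 0} E' = insert {x, y 0} E"
    using x1(1) by (auto simp: E'_def D_def)
  ultimately show ?case by simp
qed

text \<open>
  A maximal fan ends in a vertex missing a color \<open>\<beta>\<close> that already occurs at \<open>x\<close>, on the fan edge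
  to some \<open>y i\<close>. Of the vertices \<open>x\<close>, \<open>y (i - 1)\<close>, \<open>y n\<close>, each missing \<open>\<alpha>\<close> or \<open>\<beta>\<close>, at most two lie on a
  common \<open>\<alpha>\<close>-\<open>\<beta>\<close>-path, so a swap frees \<open>\<alpha>\<close> at the end of a fan without disturbing \<open>x\<close>.
\<close>

lemma edge_coloring_extend:
  assumes fin: "finite E" and card_2: "\<forall>e\<in>E. card e = 2" and col: "edge_coloring E k c"
    and new: "x \<noteq> y\<^sub>0" "{x, y\<^sub>0} \<notin> E" and deg: "\<And>v. vertex_degree E v < k"
  shows "\<exists>c'. edge_coloring (insert {x, y\<^sub>0} E) k c'"
proof -
  \<comment> \<open>The fan edges at \<open>x\<close> are distinct, so fans have bounded length and
    a longest one exists.\<close>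
  have bound: "n \<le> vertex_degree E x" if "is_fan E c x y n" for y n
  proof -
    have "card (y ` {1..n}) \<le> card {w. {x, w} \<in> E}"
    proof (rule card_mono[OF finite_neighbors[OF fin card_2]], safe)
      fix j assume "j \<in> {1..n}"
      then show "{x, y j} \<in> E" using that by (cases j) (auto simp: is_fan_def)
    qed
    moreover have "card (y ` {1..n}) = n"
      using that by (subst card_image) (auto simp: is_fan_def intro: inj_on_subset)
    ultimately show ?thesis by (simp add: vertex_degree_eq[OF card_2])
  qed
  let ?P = "\<lambda>n. \<exists>y. y 0 = y\<^sub>0 \<and> is_fan E c x y n"
  have P0: "?P 0" using new by (intro exI[of _ "\<lambda>_. y\<^sub>0"]) (auto simp: is_fan_def)
  have le: "m \<le> vertex_degree E x" if "?P m" for m using bound that by blast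
  obtain n where "?P n" and max: "\<And>m. ?P m \<Longrightarrow> m \<le> n"
    using GreatestI_nat[where P="?P", OF P0 le] Greatest_le_nat[where P="?P", OF _ le] by blast
  then obtain y where y0: "y 0 = y\<^sub>0" and fan: "is_fan E c x y n" by blast
  have inj: "inj_on y {..n}"
    and step: "\<And>j. j < n \<Longrightarrow> {x, y (Suc j)} \<in> E \<and> c {x, y (Suc j)} \<notin> colors_at E c (y j)"
    using fan by (auto simp: is_fan_def)
  obtain \<alpha> where \<alpha>: "\<alpha> \<in> {1..k}" "\<alpha> \<notin> colors_at E c x" using ex_missing_color[OF col deg] .
  obtain \<beta> where \<beta>: "\<beta> \<in> {1..k}" "\<beta> \<notin> colors_at E c (y n)" using ex_missing_color[OF col deg] .
  show ?thesis
  proof (cases "\<beta> \<in> colors_at E c x")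
    case False
    then show ?thesis using fan_rotate[OF card_2 col fan \<beta>(1)] \<beta>(2) y0 by simp
  next
    case True
    then obtain z where z: "{x, z} \<in> E" "c {x, z} = \<beta>" using colors_at_iff[OF card_2] by metis
    have "z \<in> y ` {..n}"
    proof (rule ccontr)
      assume "z \<notin> y ` {..n}"
      then have "is_fan E c x (y(Suc n := z)) (Suc n)"
        using fan z \<beta>(2) unfolding is_fan_def
        by (auto simp: atMost_Suc inj_on_def less_Suc_eq)
      then have "?P (Suc n)" using y0 by (intro exI[of _ "y(Suc n := z)"]) simp
      then show False using max[of "Suc n"] by simp
    qed
    then obtain i where i: "i \<le> n" "z = y i" by blast
    have "i \<noteq> 0" using i(2) y0 new(2) z(1) by metis
    then obtain l where l: "i = Suc l" by (cases i) auto
    have x_yn: "c {x, y n} \<in> colors_at E c (y n)" if "{x, y n} \<in> E"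
      using that by (auto simp: colors_at_def incident_edges_def)
    then have "i \<noteq> n" using i z \<beta>(2) by metis
    then have ln: "l < n" "Suc l < n" using i l by auto
    have xl: "c {x, y (Suc l)} = \<beta>" using z i l by simp
    then have \<beta>l: "\<beta> \<notin> colors_at E c (y l)" using step[OF ln(1)] by simp
    have yl_n: "y l \<noteq> y n" using inj_onD[OF inj, of l n] ln by auto
    \<comment> \<open>The fan is cut at \<open>p = l\<close>, just before the edge of color \<beta>,
      or kept whole. In the second case \<open>y l\<close> must stay off the swapped path, since it
      has to go on missing \<beta>.\<close>
    have "\<exists>p\<le>n. p \<in> {l, n} \<and> (x, y p) \<notin> (kempe E c \<alpha> \<beta>)\<^sup>* \<and>
        (p = n \<longrightarrow> (y n, y l) \<notin> (kempe E c \<alpha> \<beta>)\<^sup>*)"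
    proof (cases "(x, y l) \<in> (kempe E c \<alpha> \<beta>)\<^sup>*")
      case False
      then show ?thesis using ln by (intro exI[of _ l]) auto
    next
      case True
      then have "(x, y n) \<notin> (kempe E c \<alpha> \<beta>)\<^sup>*"
        using kempe_ends[OF card_2 col \<alpha>(2) \<beta>l \<beta>(2)] yl_n by blast
      moreover from this have "(y n, y l) \<notin> (kempe E c \<alpha> \<beta>)\<^sup>*"
        using True by (metis kempe_connected_sym rtrancl_trans)
      ultimately show ?thesis by blast
    qed
    then obtain p where p: "p \<le> n" "p = l \<or> p = n" "(x, y p) \<notin> (kempe E c \<alpha> \<beta>)\<^sup>*"
      "p = n \<Longrightarrow> (y n, y l) \<notin> (kempe E c \<alpha> \<beta>)\<^sup>*" by blast
    define K where "K = (kempe E c \<alpha> \<beta>)\<^sup>* `` {y p}"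
    obtain c' where c': "edge_coloring E k c'"
      "\<And>v w. {v, w} \<in> E \<Longrightarrow>
        c' {v, w} = (if v \<in> K then transpose \<alpha> \<beta> (c {v, w}) else c {v, w})"
      "\<And>v. v \<in> K \<Longrightarrow> colors_at E c' v = transpose \<alpha> \<beta> ` colors_at E c v"
      "\<And>v. v \<notin> K \<Longrightarrow> colors_at E c' v = colors_at E c v"
      using kempe_swap[OF card_2 col \<alpha>(1) \<beta>(1) K_def] by blast
    have xK: "x \<notin> K" using p(3) kempe_connected_sym unfolding K_def by fastforce
    have pK: "y p \<in> K" by (simp add: K_def)
    have "\<beta> \<notin> colors_at E c (y p)" using p(2) \<beta>l \<beta>(2) by blast
    then have "\<alpha> \<notin> colors_at E c' (y p)" unfolding c'(3)[OF pK] by (auto simp: transpose_def split: if_splits)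
    moreover have "\<alpha> \<notin> colors_at E c' x" using c'(4)[OF xK] \<alpha>(2) by simp
    moreover have "is_fan E c' x y p"
      unfolding is_fan_def
    proof (intro conjI allI impI)
      show "inj_on y {..p}" using inj p(1) by (auto intro: inj_on_subset)
      show "x \<noteq> y 0" "{x, y 0} \<notin> E" using new y0 by auto
      fix j assume j: "j < p"
      then have jn: "j < n" using p(1) by simp
      show xj: "{x, y (Suc j)} \<in> E" using step[OF jn] by blast
      have eq: "c' {x, y (Suc j)} = c {x, y (Suc j)}" using c'(2)[OF xj] xK by simp
      have miss: "c {x, y (Suc j)} \<notin> colors_at E c (y j)" using step[OF jn] by blast
      show "c' {x, y (Suc j)} \<notin> colors_at E c' (y j)"
      proof (cases "y j \<in> K")
        case False
        then show ?thesis using eq miss c'(4) by simp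
      next
        case True
        \<comment> \<open>At \<open>x\<close> the color \<alpha> is missing and \<beta> occurs only
          on the fan edge following \<open>y l\<close>. Every other fan color is fixed by the
          transposition, so the swap cannot destroy its fan condition.\<close>
        have "j \<noteq> l"
        proof
          assume "j = l"
          then have "p = n" using j p(2) by blast
          then show False using p(4) True \<open>j = l\<close> by (simp add: K_def)
        qed
        have "c {x, y (Suc j)} \<noteq> \<alpha>" using \<alpha>(2) xj colors_at_iff[OF card_2] by metis
        moreover have "c {x, y (Suc j)} \<noteq> \<beta>"
        proof
          assume "c {x, y (Suc j)} = \<beta>"
          then have "y (Suc j) = y (Suc l)"
            using edge_coloring_inj[OF col xj] step[OF ln(1)] xl by metis
          then show False using inj_onD[OF inj, of "Suc j" "Suc l"] jn ln \<open>j \<noteq> l\<close> by auto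
        qed
        ultimately show ?thesis using eq miss c'(3)[OF True] by (auto simp: transpose_def split: if_splits)
      qed
    qed
    ultimately show ?thesis using fan_rotate[OF card_2 c'(1) _ \<alpha>(1)] y0 by metis
  qed
qed

theorem vizing:
  assumes "finite E" "\<forall>e\<in>E. card e = 2" "\<And>v. vertex_degree E v \<le> r"
  shows "\<exists>c. edge_coloring E (Suc r) c"
  using assms
proof (induction E rule: finite_induct)
  case empty
  then show ?case by (simp add: edge_coloring_def)
next
  case (insert e E)
  have inc: "incident_edges (insert e E) v = (if v \<in> e then insert e (incident_edges E v)
      else incident_edges E v)" for v
    by (auto simp: incident_edges_def)
  have "finite (incident_edges E v)" for v using insert.hyps(1) by (simp add: incident_edges_def)
  then have "vertex_degree E v \<le> vertex_degree (insert e E) v" for v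
    by (simp add: vertex_degree_def inc card_insert_le)
  then have deg: "vertex_degree E v \<le> r" for v using insert.prems(2) le_trans by blast
  then obtain c where c: "edge_coloring E (Suc r) c" using insert by auto
  obtain x y where "e = {x, y}" "x \<noteq> y" using insert.prems(1) by (auto simp: card_2_iff)
  then show ?case
    using edge_coloring_extend[OF insert.hyps(1) _ c] insert.prems(1) insert.hyps(2) deg
    by (simp add: less_Suc_eq_le)
qed

section \<open>Splitting color classes\<close>

text \<open>Applied below with \<open>i = 1\<close>, where it rules out such edges altogether, and
  with \<open>i = 2\<close>, where it forces color 1.\<close>

lemma ex_coloring_min_missing:
  assumes fin: "finite E" and card_2: "\<forall>e\<in>E. card e = 2" and ex: "\<exists>c. edge_coloring E k c"
  obtains c where "edge_coloring E k c"
    and "\<And>x y i. {x, y} \<in> E \<Longrightarrow> i \<in> {1..k} \<Longrightarrow> i \<notin> colors_at E c x \<Longrightarrow> i \<notin> colors_at E c y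
      \<Longrightarrow> c {x, y} < i"
proof -
  obtain c where col: "edge_coloring E k c"
    and min: "\<And>c'. edge_coloring E k c' \<Longrightarrow> sum c E \<le> sum c' E"
    using ex_has_least_nat[of "edge_coloring E k" _ "\<lambda>c. sum c E"] ex by blast
  have "c {x, y} < i"
    if xy: "{x, y} \<in> E" and i: "i \<in> {1..k}" "i \<notin> colors_at E c x" "i \<notin> colors_at E c y" for x y i
  proof -
    define D where "D = E - {{x, y}}"
    have D: "\<forall>e\<in>D. card e = 2" "edge_coloring D k c" "{x, y} \<notin> D" "insert {x, y} D = E"
      using card_2 col xy by (auto simp: D_def edge_coloring_def)
    have "colors_at D c v \<subseteq> colors_at E c v" for v
      by (auto simp: colors_at_def incident_edges_def D_def)
    moreover have "x \<noteq> y" using card_2 xy by force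
    ultimately have "edge_coloring E k (c({x, y} := i))"
      using edge_coloring_insert[OF D(1,2) _ i(1) D(3)] i D(4) by (metis subsetD)
    then have "sum c E \<le> sum (c({x, y} := i)) E" by (rule min)
    moreover have "sum (c({x, y} := i)) D = sum c D"
      using D(3) by (intro sum.cong) auto
    ultimately have "c {x, y} \<le> i"
      using fin xy by (simp add: sum.remove[of E "{x, y}"] D_def)
    moreover have "c {x, y} \<noteq> i" using i(2) xy colors_at_iff[OF card_2] by metis
    ultimately show ?thesis by simp
  qed
  with col show thesis using that by blast
qed

text \<open>
  Among all labelings that are constant on the pairs \<open>{v, \<mu> v}\<close>, one with the fewest monochromatic
  edges cannot be improved by relabeling a single pair.
\<close>

lemma defective_labeling:
  fixes V :: "'a set" and F :: "'a \<Rightarrow> 'a \<Rightarrow> bool" and \<mu> :: "'a \<Rightarrow> 'a"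
  assumes fin: "finite V" and \<mu>: "\<And>v. \<mu> (\<mu> v) = v"
    and F: "\<And>u w. F u w \<Longrightarrow> u \<in> V \<and> w \<in> V \<and> u \<noteq> w \<and> F w u" and q: "q > 0"
    and b: "\<And>v. card {w. F v w \<and> w \<noteq> \<mu> v} \<le> b"
  shows "\<exists>L :: 'a \<Rightarrow> nat. (\<forall>v. L v < q) \<and> (\<forall>v. L (\<mu> v) = L v) \<and>
    (\<forall>v. card {w. F v w \<and> w \<noteq> \<mu> v \<and> L v = L w} \<le> 2 * b div q)"
proof -
  define good where "good L \<longleftrightarrow> (\<forall>v. L v < q) \<and> (\<forall>v. L (\<mu> v) = L v)" for L :: "'a \<Rightarrow> nat"
  define mono where "mono L = {(u, w). F u w \<and> L u = L w}" for L :: "'a \<Rightarrow> nat"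
  have fin_F: "finite {(u, w). F u w \<and> P u w}" for P
    by (rule finite_subset[of _ "V \<times> V"]) (use F fin in auto)
  have fin_F1: "finite {w. F v w \<and> P w}" for v P
    by (rule finite_subset[of _ V]) (use F fin in auto)
  have "good (\<lambda>_. 0)" using q by (simp add: good_def)
  then obtain L where L: "good L" and min: "\<And>L'. good L' \<Longrightarrow> card (mono L) \<le> card (mono L')"
    using ex_has_least_nat[of good _ "\<lambda>L. card (mono L)"] by blast
  have "card {w. F v w \<and> w \<noteq> \<mu> v \<and> L v = L w} \<le> 2 * b div q" for v
  proof -
    define P where "P = {v, \<mu> v}"
    \<comment> \<open>\<open>D k\<close> holds the edges leaving the pair that become monochromatic
      when it is labeled \<open>k\<close>; \<open>A\<close> holds the monochromatic edges not
      crossing its boundary, which do not depend on \<open>k\<close>. Since \<open>mono\<close>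
      consists of ordered pairs, \<open>D k\<close> counts twice.\<close>
    define D where "D k = {(u, w). F u w \<and> u \<in> P \<and> w \<notin> P \<and> L w = k}" for k
    define A where "A = {(u, w). F u w \<and> (u \<in> P \<longleftrightarrow> w \<in> P) \<and> L u = L w}"
    have fin_D: "finite (D k)" for k unfolding D_def by (rule fin_F)
    have P_\<mu>: "\<mu> u \<in> P \<longleftrightarrow> u \<in> P" for u unfolding P_def using \<mu> by (metis insert_iff singletonD)
    have LP: "L u = L v" if "u \<in> P" for u using that L by (auto simp: P_def good_def)
    have card_mono_eq: "card (mono (\<lambda>u. if u \<in> P then k else L u)) = card A + 2 * card (D k)" for k
    proof -
      have "mono (\<lambda>u. if u \<in> P then k else L u) = A \<union> (D k \<union> (D k)\<inverse>)"
      proof (rule set_eqI, unfold split_paired_all)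
        fix u w
        have "F u w \<longleftrightarrow> F w u" using F by blast
        then show "(u, w) \<in> mono (\<lambda>u. if u \<in> P then k else L u) \<longleftrightarrow> (u, w) \<in> A \<union> (D k \<union> (D k)\<inverse>)"
          using LP[of u] LP[of w] unfolding mono_def A_def D_def
          by (cases "u \<in> P"; cases "w \<in> P") auto
      qed
      moreover have "finite A" unfolding A_def by (rule fin_F)
      moreover have "A \<inter> (D k \<union> (D k)\<inverse>) = {}" "D k \<inter> (D k)\<inverse> = {}"
        by (auto simp: A_def D_def)
      ultimately show ?thesis using fin_D by (simp add: card_Un_disjoint)
    qed
    have "card (D (L v)) \<le> card (D k)" if "k < q" for k
    proof -
      have "good (\<lambda>u. if u \<in> P then k else L u)" using L that P_\<mu> by (auto simp: good_def)
      moreover have "(\<lambda>u. if u \<in> P then L v else L u) = L" using LP by auto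
      ultimately show ?thesis using min card_mono_eq[of k] card_mono_eq[of "L v"] by fastforce
    qed
    \<comment> \<open>Averaging: at most \<open>2 * b\<close> edges leave the pair, and its current
      label is the cheapest of the \<open>q\<close> choices.\<close>
    then have "(\<Sum>k<q. card (D (L v))) \<le> (\<Sum>k<q. card (D k))" by (intro sum_mono) auto
    also have "\<dots> = card (\<Union>k<q. D k)"
      using fin_D by (intro card_UN_disjoint[symmetric]) (auto simp: D_def)
    also have "\<dots> \<le> card (Pair v ` {w. F v w \<and> w \<noteq> \<mu> v} \<union>
        Pair (\<mu> v) ` {w. F (\<mu> v) w \<and> w \<noteq> \<mu> (\<mu> v)})"
      by (rule card_mono) (use \<mu> in \<open>auto simp: D_def P_def fin_F1\<close>)
    also have "\<dots> \<le> b + b"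
      by (rule order_trans[OF card_Un_le])
        (intro add_mono order_trans[OF card_image_le b], simp_all add: fin_F1)
    finally have le: "q * card (D (L v)) \<le> 2 * b" by simp
    have "card {w. F v w \<and> w \<noteq> \<mu> v \<and> L v = L w} = card (Pair v ` {w. F v w \<and> w \<noteq> \<mu> v \<and> L v = L w})"
      by (simp add: card_image inj_on_def)
    also have "\<dots> \<le> card (D (L v))"
      by (rule card_mono[OF fin_D]) (auto simp: D_def P_def dest: F)
    finally have "card {w. F v w \<and> w \<noteq> \<mu> v \<and> L v = L w} * q \<le> 2 * b"
      using le mult_le_mono1[of _ "card (D (L v))" q] by (metis le_trans mult.commute)
    then show ?thesis using q by (simp add: less_eq_div_iff_mult_less_eq)
  qed
  then show ?thesis using L unfolding good_def by blast
qed

text \<open>Color \<open>i\<close> is replaced by \<open>q i\<close> new colors, chosen on each edge by the label of its end vertices.\<close>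

lemma split_colors:
  fixes E :: "'a set set" and L :: "nat \<Rightarrow> 'a \<Rightarrow> nat"
  assumes card_2: "\<forall>e\<in>E. card e = 2" and col: "edge_coloring E k c"
    and L: "\<And>i v. L i v < q i" "\<And>i v. L i (partner E c i v) = L i v"
    and dist: "\<And>u v. {u, v} \<in> E \<Longrightarrow> colors_at E c u = colors_at E c v
      \<Longrightarrow> \<exists>i\<in>colors_at E c u. L i u \<noteq> L i v"
  shows "\<exists>\<phi>. avd_edge_coloring E (\<Sum>i=1..k. q i) \<phi>"
proof -
  define S where "S = (SIGMA i:{1..k}. {..<q i})"
  have S: "finite S" "card S = (\<Sum>i=1..k. q i)" by (auto simp: S_def)
  then obtain g where g: "bij_betw g S {1..\<Sum>i=1..k. q i}"
    using finite_same_card_bij[of S "{1..\<Sum>i=1..k. q i}"] by auto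
  have inj: "inj_on g S" using g by (simp add: bij_betw_def)
  \<comment> \<open>An arbitrary end may be chosen: the ends of an edge are partners in its color
    and so share the relevant label.\<close>
  define \<phi> where "\<phi> e = g (c e, L (c e) (SOME v. v \<in> e))" for e
  have cS: "(c e, L (c e) v) \<in> S" if "e \<in> E" for e v
    using that col L(1) by (auto simp: S_def edge_coloring_def)
  have \<phi>: "\<phi> {v, w} = g (c {v, w}, L (c {v, w}) v)" if "{v, w} \<in> E" for v w
  proof -
    have "L (c {v, w}) w = L (c {v, w}) v"
      using L(2)[of "c {v, w}" v] partner_eq[OF card_2 col that] by metis
    moreover have "(SOME x. x \<in> {v, w}) \<in> {v, w}" by (rule someI[of _ v]) simp
    ultimately show ?thesis by (auto simp: \<phi>_def)
  qed
  have colors_\<phi>: "colors_at E \<phi> v = g ` (\<lambda>i. (i, L i v)) ` colors_at E c v" for v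
    using \<phi> by (auto simp: colors_at_def incident_edges_eq[OF card_2] image_image)
  have sub: "(\<lambda>i. (i, L i v)) ` colors_at E c v \<subseteq> S" for v
    using cS by (auto simp: colors_at_def incident_edges_def)
  have "edge_coloring E (\<Sum>i=1..k. q i) \<phi>"
    unfolding edge_coloring_def
  proof (intro conjI ballI impI)
    fix e assume "e \<in> E"
    then show "\<phi> e \<in> {1..\<Sum>i=1..k. q i}"
      unfolding \<phi>_def using cS g by (meson bij_betwE)
  next
    fix e f assume "e \<in> E" "f \<in> E" "e \<noteq> f \<and> e \<inter> f \<noteq> {}"
    moreover from this have "c e \<noteq> c f" using col by (simp add: edge_coloring_def)
    ultimately show "\<phi> e \<noteq> \<phi> f" unfolding \<phi>_def using cS inj by (metis inj_onD prod.inject)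
  qed
  moreover have "colors_at E \<phi> u \<noteq> colors_at E \<phi> v" if uv: "{u, v} \<in> E" for u v
  proof
    assume "colors_at E \<phi> u = colors_at E \<phi> v"
    then have eq: "(\<lambda>i. (i, L i u)) ` colors_at E c u = (\<lambda>i. (i, L i v)) ` colors_at E c v"
      unfolding colors_\<phi> using inj_on_image_eq_iff[OF inj sub sub] by blast
    \<comment> \<open>Forgetting the labels recovers the old color sets, so new sets can agree only
      if the old ones do.\<close>
    then have "fst ` (\<lambda>i. (i, L i u)) ` colors_at E c u = fst ` (\<lambda>i. (i, L i v)) ` colors_at E c v"
      by simp
    then have "colors_at E c u = colors_at E c v" by (simp add: image_image)
    then obtain i where i: "i \<in> colors_at E c u" "L i u \<noteq> L i v" using dist[OF uv] by blast
    then have "(i, L i u) \<in> (\<lambda>i. (i, L i v)) ` colors_at E c v" using eq by blast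
    then show False using i by auto
  qed
  ultimately show ?thesis unfolding avd_edge_coloring_def by blast
qed


lemma avd_edge_coloring_mono:
  assumes "avd_edge_coloring E k c" "k \<le> l"
  shows "avd_edge_coloring E l c"
  using assms(1) unfolding avd_edge_coloring_def edge_coloring_def
  by (auto intro: order_trans[OF _ assms(2)])

section \<open>The four splits for a regular graph\<close>

lemma regular_avd_edge_coloring:
  assumes "simple_graph V E" and reg: "regular_graph V E r" and r: "r \<ge> 2"
  defines "d \<equiv> (r - 1) div 3"
  shows "\<exists>\<phi>. avd_edge_coloring E (r + 12 + 2 * d) \<phi>"
proof -
  interpret simple_graph V E by fact
  have card_2: "\<forall>e\<in>E. card e = 2" using edge_card by blast
  have inV: "v \<in> V" if "{v, w} \<in> E" for v w using edge_subset[OF that] by simp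
  have deg_r: "vertex_degree E v = r" if "v \<in> V" for v using reg that by (simp add: regular_graph_def)
  have "vertex_degree E v \<le> r" for v
  proof (cases "v \<in> V")
    case False
    then have "incident_edges E v = {}" using edge_subset by (auto simp: incident_edges_def)
    then show ?thesis by (simp add: vertex_degree_def)
  qed (simp add: deg_r)
  then obtain c where col: "edge_coloring E (Suc r) c"
    and below: "\<And>x y i. {x, y} \<in> E \<Longrightarrow> i \<in> {1..Suc r} \<Longrightarrow> i \<notin> colors_at E c x
      \<Longrightarrow> i \<notin> colors_at E c y \<Longrightarrow> c {x, y} < i"
    using ex_coloring_min_missing[OF finite_E card_2 vizing[OF finite_E card_2]] by blast
  let ?C = "colors_at E c" and ?\<mu> = "partner E c"
  note \<mu>_eq = partner_eq[OF card_2 col]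
  have c_range: "c {x, y} \<in> {1..Suc r}" if "{x, y} \<in> E" for x y
    using col that by (simp add: edge_coloring_def)
  have missing_unique: "j \<in> ?C v"
    if "v \<in> V" "i \<in> {1..Suc r}" "i \<notin> ?C v" "j \<in> {1..Suc r}" "j \<noteq> i" for v i j
  proof -
    have "?C v \<subseteq> {1..Suc r} - {i}" using colors_at_subset[OF col] that by blast
    moreover have "card (?C v) = card ({1..Suc r} - {i})"
      using card_colors_at[OF col, of v] deg_r that by simp
    ultimately show ?thesis using card_subset_eq[of "{1..Suc r} - {i}" "?C v"] that by blast
  qed
  have color_\<mu>: "c {v, w} = i" if "w = ?\<mu> i v" "{v, w} \<in> E" for v w i
  proof -
    have "i \<in> ?C v"
    proof (rule ccontr)
      assume "i \<notin> ?C v"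
      then have "w = v" using partner_missing[OF card_2 col] that(1) by simp
      then show False using that(2) card_2 by force
    qed
    then show ?thesis using partner_edge[OF card_2 col] that(1) by blast
  qed

  define F where "F v w \<longleftrightarrow> {v, w} \<in> E \<and> ?C v = ?C w" for v w
  have F: "u \<in> V \<and> w \<in> V \<and> u \<noteq> w \<and> F w u" if "F u w" for u w
    using that inV[of u w] inV[of w u] card_2 by (force simp: F_def insert_commute)
  \<comment> \<open>Hence every conflict vertex has an edge of color 1, and leaving it out reduces
    the conflict degree to at most \<open>r - 1\<close>.\<close>
  have F_1: "1 \<in> ?C v" if "F v w" for v w
  proof (rule ccontr)
    assume "1 \<notin> ?C v"
    then have "c {v, w} < 1" using that by (intro below) (auto simp: F_def)
    then show False using c_range[of v w] that by (simp add: F_def)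
  qed
  have F_deg: "card {w. F v w \<and> w \<noteq> ?\<mu> 1 v} \<le> r - 1" for v
  proof (cases "1 \<in> ?C v \<and> v \<in> V")
    case True
    then have "{v, ?\<mu> 1 v} \<in> E" using partner_edge[OF card_2 col] by blast
    then have "card ({w. {v, w} \<in> E} - {?\<mu> 1 v}) = r - 1"
      using True deg_r finite_neighbors[OF finite_E card_2]
      by (simp add: vertex_degree_eq[OF card_2])
    moreover have "{w. F v w \<and> w \<noteq> ?\<mu> 1 v} \<subseteq> {w. {v, w} \<in> E} - {?\<mu> 1 v}"
      by (auto simp: F_def)
    ultimately show ?thesis
      using card_mono[of "{w. {v, w} \<in> E} - {?\<mu> 1 v}"] finite_neighbors[OF finite_E card_2] by fastforce
  next
    case False
    then have "{w. F v w \<and> w \<noteq> ?\<mu> 1 v} = {}" using F_1 F by blast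
    then show ?thesis by (metis card.empty zero_le)
  qed
  \<comment> \<open>Six labels turn the bound \<open>2 * (r - 1) div 6\<close> into
    \<open>d\<close>.\<close>
  have "0 < (6::nat)" by simp
  obtain L1 :: "'a \<Rightarrow> nat" where L1: "\<And>v. L1 v < 6" "\<And>v. L1 (?\<mu> 1 v) = L1 v"
    and L1_F: "\<And>v. card {w. F v w \<and> w \<noteq> ?\<mu> 1 v \<and> L1 v = L1 w} \<le> 2 * (r - 1) div 6"
    using defective_labeling[where \<mu>="?\<mu> 1", OF finite_V partner_partner[OF card_2 col] F \<open>0 < (6::nat)\<close> F_deg] by blast

  define F1 where "F1 v w \<longleftrightarrow> F v w \<and> L1 v = L1 w" for v w
  have F1: "u \<in> V \<and> w \<in> V \<and> u \<noteq> w \<and> F1 w u" if "F1 u w" for u w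
    using that F[of u w] by (auto simp: F1_def)
  have F1_finite: "finite {w. F1 v w \<and> P w}" for v P
    by (rule finite_subset[OF _ finite_V]) (use F1 in blast)
  have F1_d: "card {w. F1 v w \<and> w \<noteq> ?\<mu> 1 v} \<le> d" for v
  proof -
    have "{w. F1 v w \<and> w \<noteq> ?\<mu> 1 v} = {w. F v w \<and> w \<noteq> ?\<mu> 1 v \<and> L1 v = L1 w}"
      by (auto simp: F1_def)
    then show ?thesis using L1_F[of v] by (simp add: d_def)
  qed
  \<comment> \<open>Splitting color 2 can help only where it occurs. The edge of color 1, left out
    of the previous count, now counts again, whence \<open>d + 1\<close>.\<close>
  define F1' where "F1' v w \<longleftrightarrow> F1 v w \<and> 2 \<in> ?C v" for v w
  have F1': "u \<in> V \<and> w \<in> V \<and> u \<noteq> w \<and> F1' w u" if "F1' u w" for u w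
    using that F1[of u w] by (auto simp: F1'_def F1_def F_def)
  have F1'_deg: "card {w. F1' v w \<and> w \<noteq> ?\<mu> 2 v} \<le> d + 1" for v
  proof -
    have "card {w. F1' v w \<and> w \<noteq> ?\<mu> 2 v} \<le> card (insert (?\<mu> 1 v) {w. F1 v w \<and> w \<noteq> ?\<mu> 1 v})"
      by (rule card_mono) (auto simp: F1_finite F1'_def)
    also have "\<dots> \<le> Suc d"
      using F1_d[of v] card_insert_le_m1 by (simp add: card_insert_if F1_finite)
    finally show ?thesis by simp
  qed
  \<comment> \<open>The least number of labels exceeding \<open>2 * (d + 1)\<close>, so the quotient
    bound becomes 0.\<close>
  have "0 < 2 * d + 3" by simp
  obtain L2 :: "'a \<Rightarrow> nat" where L2: "\<And>v. L2 v < 2 * d + 3" "\<And>v. L2 (?\<mu> 2 v) = L2 v"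
    and L2_F: "\<And>v. card {w. F1' v w \<and> w \<noteq> ?\<mu> 2 v \<and> L2 v = L2 w} \<le> 2 * (d + 1) div (2 * d + 3)"
    using defective_labeling[where \<mu>="?\<mu> 2", OF finite_V partner_partner[OF card_2 col] F1' \<open>0 < 2 * d + 3\<close> F1'_deg] by blast
  have F1'_2: "w = ?\<mu> 2 v" if "F1' v w" "L2 v = L2 w" for v w
  proof -
    have "finite {w. F1' v w \<and> w \<noteq> ?\<mu> 2 v \<and> L2 v = L2 w}"
      by (rule finite_subset[OF _ finite_V]) (use F1' in blast)
    then have "{w. F1' v w \<and> w \<noteq> ?\<mu> 2 v \<and> L2 v = L2 w} = {}" using L2_F[of v] by simp
    then show ?thesis using that by blast
  qed

  define F2 where "F2 v w \<longleftrightarrow> F1 v w \<and> (2 \<in> ?C v \<longrightarrow> L2 v = L2 w)" for v w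
  have F2: "u \<in> V \<and> w \<in> V \<and> u \<noteq> w \<and> F2 w u" if "F2 u w" for u w
    using that F1[of u w] by (auto simp: F2_def F1_def F_def)
  have F2_color: "c {v, w} = (if 2 \<in> ?C v then 2 else 1)" if "F2 v w" for v w
  proof -
    have vw: "{v, w} \<in> E" "?C v = ?C w" using that by (auto simp: F2_def F1_def F_def)
    show ?thesis
    proof (cases "2 \<in> ?C v")
      case True
      then have "w = ?\<mu> 2 v" using that by (intro F1'_2) (auto simp: F2_def F1'_def)
      then show ?thesis using color_\<mu> vw True by simp
    next
      case False
      then have "c {v, w} < 2" using vw r by (intro below) auto
      then show ?thesis using False c_range[OF vw(1)] by simp
    qed
  qed
  \<comment> \<open>The surviving conflicts form a matching, so three labels suffice from here on:
    \<open>2 * 1 div 3 = 0\<close>.\<close>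
  have F2_deg: "card {w. F2 v w \<and> w \<noteq> ?\<mu> i v} \<le> 1" for i v
  proof -
    have "w = ?\<mu> (if 2 \<in> ?C v then 2 else 1) v" if "F2 v w" for w
      using \<mu>_eq[of v w] F2_color[OF that] that by (auto simp: F2_def F1_def F_def)
    then have "{w. F2 v w \<and> w \<noteq> ?\<mu> i v} \<subseteq> {?\<mu> (if 2 \<in> ?C v then 2 else 1) v}" by blast
    then show ?thesis using card_mono[of "{?\<mu> (if 2 \<in> ?C v then 2 else 1) v}"] by fastforce
  qed
  have ex_L: "\<forall>i. \<exists>L::'a \<Rightarrow> nat. (\<forall>v. L v < 3) \<and> (\<forall>v. L (?\<mu> i v) = L v) \<and>
      (\<forall>v. card {w. F2 v w \<and> w \<noteq> ?\<mu> i v \<and> L v = L w} \<le> 2 * 1 div 3)"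
    by (intro allI, rule defective_labeling[OF finite_V partner_partner[OF card_2 col] F2 _ F2_deg]) simp_all
  obtain L' :: "nat \<Rightarrow> 'a \<Rightarrow> nat" where L'_all: "\<And>i. (\<forall>v. L' i v < 3) \<and>
      (\<forall>v. L' i (?\<mu> i v) = L' i v) \<and>
      (\<forall>v. card {w. F2 v w \<and> w \<noteq> ?\<mu> i v \<and> L' i v = L' i w} \<le> 2 * 1 div 3)"
    using choice[OF ex_L] by (elim exE) (rule that, erule spec)
  have L': "L' i v < 3" "L' i (?\<mu> i v) = L' i v" for i v
    using L'_all[of i] by simp_all
  have L'_F: "card {w. F2 v w \<and> w \<noteq> ?\<mu> i v \<and> L' i v = L' i w} \<le> 2 * 1 div 3" for i v
    using L'_all[of i] by simp
  \<comment> \<open>A split of color \<open>i\<close> resolves every surviving conflict at a vertex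
    seeing \<open>i\<close>, except a conflict of color \<open>i\<close> itself.\<close>
  have F2_i: "c {v, w} = i" if "F2 v w" "L' i v = L' i w" for v w i
  proof -
    have "finite {w. F2 v w \<and> w \<noteq> ?\<mu> i v \<and> L' i v = L' i w}"
      by (rule finite_subset[OF _ finite_V]) (use F2 in blast)
    then have "{w. F2 v w \<and> w \<noteq> ?\<mu> i v \<and> L' i v = L' i w} = {}" using L'_F[of v i] by simp
    then have "w = ?\<mu> i v" using that by blast
    then show ?thesis using that(1) by (intro color_\<mu>) (auto simp: F2_def F1_def F_def)
  qed

  define q where "q i = (if i = 1 then 6 else if i = 2 then 2 * d + 3 else
      if i = 3 \<or> i = 4 then 3 else 1)" for i :: nat
  define L where "L i = (if i = 1 then L1 else if i = 2 then L2 else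
      if i = 3 \<or> i = 4 then L' i else (\<lambda>_. 0))" for i :: nat
  have "\<exists>\<phi>. avd_edge_coloring E (\<Sum>i=1..Suc r. q i) \<phi>"
  proof (rule split_colors[OF card_2 col])
    show "L i v < q i" "L i (?\<mu> i v) = L i v" for i v
      using L1 L2 L' by (auto simp: L_def q_def)
    fix u v assume uv: "{u, v} \<in> E" "?C u = ?C v"
    show "\<exists>i\<in>?C u. L i u \<noteq> L i v"
    proof (rule ccontr)
      assume "\<not> (\<exists>i\<in>?C u. L i u \<noteq> L i v)"
      then have eq: "L i u = L i v" if "i \<in> ?C u" for i using that by blast
      have "F u v" using uv by (simp add: F_def)
      moreover have "L1 u = L1 v" using eq[of 1] F_1[OF \<open>F u v\<close>] by (simp add: L_def)
      ultimately have "F1 u v" by (simp add: F1_def)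
      moreover have "2 \<in> ?C u \<Longrightarrow> L2 u = L2 v" using eq[of 2] by (simp add: L_def)
      ultimately have "F2 u v" by (simp add: F2_def)
      then have le_2: "c {u, v} \<le> 2" using F2_color by simp
      \<comment> \<open>The edge has color at most 2, so had \<open>u\<close> color 3 or 4, that
        split would have resolved it. Only one color of \<open>{1..Suc r}\<close> is missing at
        \<open>u\<close>, so 4 lies outside the palette.\<close>
      have "i \<notin> ?C u" if "i = 3 \<or> i = 4" for i
        using F2_i[OF \<open>F2 u v\<close>, of i] eq[of i] le_2 that by (auto simp: L_def)
      then have 34: "3 \<notin> ?C u" "4 \<notin> ?C u" by simp_all
      have uV: "u \<in> V" using inV uv(1) .
      have "r = 2" using missing_unique[OF uV, of 3 4] 34 r by fastforce
      \<comment> \<open>there is no color 4, but \<open>d = 0\<close>, so the first split left only edges of color 1\<close>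
      then have "{w. F1 u w \<and> w \<noteq> ?\<mu> 1 u} = {}" using F1_d[of u] F1_finite by (simp add: d_def)
      then have "v = ?\<mu> 1 u" using \<open>F1 u v\<close> by blast
      then have "c {u, v} = 1" using color_\<mu> uv(1) by simp
      moreover have "2 \<in> ?C u" using missing_unique[OF uV, of 3 2] 34 \<open>r = 2\<close> by simp
      ultimately show False using F2_color[OF \<open>F2 u v\<close>] by simp
    qed
  qed
  moreover have "(\<Sum>i=1..Suc r. q i) \<le> r + 12 + 2 * d"
  proof -
    \<comment> \<open>Only an inequality, since for \<open>r = 2\<close> the palette has no color
      4.\<close>
    have "(\<Sum>i=1..Suc r. q i) \<le> (\<Sum>i=1..Suc r. 1 + ((if i = 1 then 5 else 0) +
        ((if i = 2 then 2 * d + 2 else 0) + ((if i = 3 then 2 else 0) + (if i = 4 then 2 else 0)))))"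
      by (rule sum_mono) (auto simp: q_def)
    also have "\<dots> \<le> Suc r + (5 + ((2 * d + 2) + (2 + 2)))"
      unfolding sum.distrib by (intro add_mono) auto
    finally show ?thesis by simp
  qed
  ultimately show ?thesis using avd_edge_coloring_mono by blast
qed

theorem theorem3p3:
  fixes V :: "'a set" and E :: "'a set set" and r :: nat
  assumes "simple_graph V E"
    and "regular_graph V E r"
    and "r \<ge> 2"
  shows "real (avd_chromatic_index E) \<le> (5 * real r + 37) / 3"
proof -
  have "avd_chromatic_index E \<le> r + 12 + 2 * ((r - 1) div 3)"
    unfolding avd_chromatic_index_def
    using regular_avd_edge_coloring[OF assms] by (rule Least_le)
  then have "3 * avd_chromatic_index E \<le> 5 * r + 37" using assms(3) by linarith
  then have "real (3 * avd_chromatic_index E) \<le> real (5 * r + 37)" by (simp only: of_nat_le_iff)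
  then show ?thesis by simp
qed

end
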